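(* Let $p$ be a prime, $q=p^e$, $m,k\ge1$, and let $f\in\mathbb{F}_{q^m}[x_1,\dots,x_k]$ be a polynomial of degree $d$. Then \[\nu_p\big(N(f=y^q-y)\big)\ge\Big\lceil\frac{emk}{W_p(d,\mathbb{F}_{q^m}^k)}\Big\rceil,\] where $W_p(d,\mathbb{F}_{q^m}^k)=\max\{S_p(t_1)+\cdots+S_p(t_k):\boldsymbol{t}=(t_1,\dots,t_k)\in[0,q^m-1]^k,\ |\boldsymbol{t}|\le d\}$.
   Context: $N(f=y^q-y)$ denotes the number of $(x_1,\dots,x_k,y)\in\mathbb{F}_{q^m}^{k+1}$ with $f(x_1,\dots,x_k)=y^q-y$; $\nu_p$ is the $p$-adic valuation; $S_p(a)$ is the sum of the base-$p$ digits of $a$; $|\boldsymbol{t}|=\sum t_i$. *)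

theory Defs
  imports Complex_Main "HOL-Library.Poly_Mapping" "HOL-Library.FuncSet" "HOL-Computational_Algebra.Primes"
begin

text \<open>Multivariate polynomials in variables x_0,...,x_(k-1) are represented, as usual,
  by finitely supported maps from monomials (exponent vectors) to coefficients.\<close>


definition mpoly_vars_in :: "((nat \<Rightarrow>\<^sub>0 nat) \<Rightarrow>\<^sub>0 'a::zero) \<Rightarrow> nat \<Rightarrow> bool" where
  "mpoly_vars_in f k \<longleftrightarrow> (\<forall>mon\<in>Poly_Mapping.keys f. Poly_Mapping.keys mon \<subseteq> {..<k})"

definition mpoly_eval :: "((nat \<Rightarrow>\<^sub>0 nat) \<Rightarrow>\<^sub>0 'a::comm_semiring_1) \<Rightarrow> (nat \<Rightarrow> 'a) \<Rightarrow> 'a" where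
  "mpoly_eval f x = (\<Sum>mon\<in>Poly_Mapping.keys f. Poly_Mapping.lookup f mon * (\<Prod>i\<in>Poly_Mapping.keys mon. x i ^ Poly_Mapping.lookup mon i))"

text \<open>Total degree (the zero polynomial gets degree 0 by this convention).\<close>
definition mpoly_total_degree :: "((nat \<Rightarrow>\<^sub>0 nat) \<Rightarrow>\<^sub>0 'a::zero) \<Rightarrow> nat" where
  "mpoly_total_degree f = Max (insert 0 ((\<lambda>mon. \<Sum>i\<in>Poly_Mapping.keys mon. Poly_Mapping.lookup mon i) ` Poly_Mapping.keys f))"

definition N_count :: "((nat \<Rightarrow>\<^sub>0 nat) \<Rightarrow>\<^sub>0 'a::{finite,field}) \<Rightarrow> nat \<Rightarrow> nat \<Rightarrow> nat" where
  "N_count f k q = card {(x, y). x \<in> ({..<k} \<rightarrow>\<^sub>E (UNIV :: 'a set)) \<and> mpoly_eval f x = y ^ q - y}"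

function digit_sum :: "nat \<Rightarrow> nat \<Rightarrow> nat" where
  "digit_sum p a = (if p < 2 \<or> a = 0 then 0 else a mod p + digit_sum p (a div p))"
  by auto
termination by (relation "measure (\<lambda>(p, a). a)") auto

definition W_p :: "nat \<Rightarrow> nat \<Rightarrow> nat \<Rightarrow> nat \<Rightarrow> nat" where
  "W_p p d Q k = Max {(\<Sum>i<k. digit_sum p (t i)) | t.
      t \<in> ({..<k} \<rightarrow>\<^sub>E {0..Q - 1}) \<and> (\<Sum>i<k. t i) \<le> d}"

end

theory Submission
  imports Defs "HOL-Number_Theory.Residues"
begin

text \<open>
  The map \<open>L y = y^q - y\<close> is additive. If its kernel has \<open>p^s\<close> elements, then
  \<open>N = p^s \<cdot> #{x. f x \<in> range L}\<close>, and membership in \<open>range L\<close> is the simultaneous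
  vanishing of \<open>s\<close> coordinates modulo \<open>p\<close>. In coordinates over the prime field, \<open>x\<close> runs
  through the box \<open>[0, p - 1]^n\<close> with \<open>n = emk\<close>. Since Frobenius is additive, each coordinate of
  \<open>f x\<close> is congruent to an integer polynomial of degree at most \<open>W\<close> in these \<open>n\<close> variables.

  The rest is an elementary argument of Ax--Katz type. The indicator of \<open>p dvd y\<close> is
  \<open>\<Sum>i. c_i (y choose i)\<close> with \<open>p^((i - 1) div (p - 1)) dvd c_i\<close> (Fleck), and summing an
  integer-valued polynomial of degree \<open>r\<close> over the box gives a multiple of
  \<open>p^(n - r div (p - 1))\<close>. Balancing these two estimates over a product of \<open>s\<close> indicators shows
  that \<open>#{x. f x \<in> range L}\<close> is divisible by \<open>p^(v - s)\<close> where \<open>v\<close> is the ceiling of \<open>n/W\<close>.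
\<close>

section \<open>Forward differences on the naturals\<close>

definition diff1 :: "(nat \<Rightarrow> int) \<Rightarrow> nat \<Rightarrow> int" where
  "diff1 g y = g (Suc y) - g y"

text \<open>The shift by \<open>y\<close> is \<open>(1 + \<Delta>)^y\<close>, expanded binomially;
  Pascal's rule drives the induction, whose hypothesis is used at base point
  \<open>Suc x\<close>.\<close>

lemma newton_forward:
  "g (x + y) = (\<Sum>i\<le>y. int (y choose i) * (diff1 ^^ i) g x)"
proof (induction y arbitrary: x)
  case 0
  show ?case by simp
next
  case (Suc y)
  let ?D = "\<lambda>i. (diff1 ^^ i) g x"
  have "g (x + Suc y) = (\<Sum>i\<le>y. int (y choose i) * (diff1 ^^ i) g (Suc x))"
    using Suc[of "Suc x"] by simp
  also have "\<dots> = (\<Sum>i\<le>y. int (y choose i) * (?D (Suc i) + ?D i))"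
    by (simp add: diff1_def)
  also have "\<dots> = (\<Sum>i\<le>y. int (y choose i) * ?D (Suc i)) + (\<Sum>i\<le>Suc y. int (y choose i) * ?D i)"
    by (simp add: ring_distribs sum.distrib)
  also have "(\<Sum>i\<le>Suc y. int (y choose i) * ?D i)
      = ?D 0 + (\<Sum>i\<le>y. int (y choose Suc i) * ?D (Suc i))"
    by (subst sum.atMost_Suc_shift) simp
  also have "(\<Sum>i\<le>y. int (y choose i) * ?D (Suc i)) + (?D 0 + (\<Sum>i\<le>y. int (y choose Suc i) * ?D (Suc i)))
      = ?D 0 + (\<Sum>i\<le>y. int (Suc y choose Suc i) * ?D (Suc i))"
    by (simp add: ring_distribs sum.distrib)
  also have "\<dots> = (\<Sum>i\<le>Suc y. int (Suc y choose i) * ?D i)"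
    unfolding sum.atMost_Suc_shift by simp
  finally show ?case .
qed

text \<open>Adding up Newton's formula at 0 turns \<open>t choose i\<close> into
  \<open>n choose Suc i\<close>, the hockey-stick identity.\<close>

lemma sum_newton_forward:
  "(\<Sum>t<n. g t) = (\<Sum>i<n. int (n choose Suc i) * (diff1 ^^ i) g 0)"
proof (induction n)
  case 0
  show ?case by simp
next
  case (Suc n)
  have "(\<Sum>t<Suc n. g t) = (\<Sum>i<Suc n. int (n choose Suc i) * (diff1 ^^ i) g 0)
     + (\<Sum>i<Suc n. int (n choose i) * (diff1 ^^ i) g 0)"
    using Suc newton_forward[of g 0 n] by (simp add: lessThan_Suc_atMost[symmetric])
  also have "\<dots> = (\<Sum>i<Suc n. int (Suc n choose Suc i) * (diff1 ^^ i) g 0)"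
    by (simp add: ring_distribs add.commute flip: sum.distrib)
  finally show ?case .
qed

lemma diff1_sum: "diff1 (\<lambda>y. \<Sum>i\<in>I. c i * g i y) = (\<lambda>y. \<Sum>i\<in>I. c i * diff1 (g i) y)"
  by (auto simp: diff1_def fun_eq_iff sum_subtractf ring_distribs)

lemma funpow_diff1_sum:
  "(diff1 ^^ n) (\<lambda>y. \<Sum>i\<in>I. c i * g i y) = (\<lambda>y. \<Sum>i\<in>I. c i * (diff1 ^^ n) (g i) y)"
  by (induction n) (auto simp: diff1_sum)

text \<open>With the shift operator \<open>E = 1 + \<Delta>\<close>, periodicity reads \<open>(1 + \<Delta>)^p = 1\<close>, so
  \<open>\<Delta>^p\<close> is \<open>p\<close> times an integral combination of \<open>\<Delta>, \<dots>, \<Delta>^(p - 1)\<close>.\<close>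
lemma fleck_periodic:
  assumes "prime p" and per: "\<And>y. g (y + p) = g y"
  shows "int p ^ ((i - 1) div (p - 1)) dvd (diff1 ^^ i) g y"
proof (induction i arbitrary: y rule: less_induct)
  case (less i)
  have p2: "p \<ge> 2" using assms(1) by (simp add: prime_ge_2_nat)
  show ?case
  proof (cases "i < p")
    case True
    then have "(i - 1) div (p - 1) = 0" using p2 by (intro div_less) auto
    then show ?thesis by simp
  next
    case False
    define i' where "i' = i - p"
    have i: "i = i' + p" using False i'_def by simp
    have top: "(diff1 ^^ p) g x = (\<Sum>k\<in>{1..<p}. - int (p choose k) * (diff1 ^^ k) g x)" for x
    proof -
      have "g x = (\<Sum>k\<le>p. int (p choose k) * (diff1 ^^ k) g x)"
        using newton_forward[of g x p] per by simp
      also have "{..p} = insert 0 (insert p {1..<p})" by auto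
      also have "(\<Sum>k\<in>\<dots>. int (p choose k) * (diff1 ^^ k) g x)
        = g x + (diff1 ^^ p) g x + (\<Sum>k\<in>{1..<p}. int (p choose k) * (diff1 ^^ k) g x)"
        using p2 by simp
      finally show ?thesis by (simp add: sum_negf)
    qed
    have "(diff1 ^^ i) g y = (diff1 ^^ i') ((diff1 ^^ p) g) y"
      by (simp add: i funpow_add)
    also have "(diff1 ^^ p) g = (\<lambda>x. \<Sum>k\<in>{1..<p}. - int (p choose k) * (diff1 ^^ k) g x)"
      using top by blast
    also have "(diff1 ^^ i') \<dots> y = (\<Sum>k\<in>{1..<p}. - int (p choose k) * (diff1 ^^ (i' + k)) g y)"
      by (subst funpow_diff1_sum) (simp add: funpow_add)
    also have "int p ^ ((i - 1) div (p - 1)) dvd \<dots>"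
    proof (rule dvd_sum)
      fix k assume k: "k \<in> {1..<p}"
      have "int p dvd int (p choose k)"
        using k assms(1) by (simp add: dvd_choose_prime)
      moreover have "int p ^ ((i' + k - 1) div (p - 1)) dvd (diff1 ^^ (i' + k)) g y"
        using k by (intro less) (auto simp: i)
      ultimately have "int p * int p ^ ((i' + k - 1) div (p - 1))
          dvd int (p choose k) * (diff1 ^^ (i' + k)) g y"
        by (rule mult_dvd_mono)
      \<comment> \<open>As \<open>k \<ge> 1\<close>, passing from \<open>i\<close> to
        \<open>i' + k\<close> lowers the index by at most \<open>p - 1\<close>, so the quotient
        drops by at most one; the factor \<open>p\<close> of the binomial coefficient repays
        this.\<close>
      moreover have "(i - 1) div (p - 1) \<le> Suc ((i' + k - 1) div (p - 1))"
      proof -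
        have "(i - 1) div (p - 1) \<le> (i' + k - 1 + (p - 1)) div (p - 1)"
          using k p2 by (intro div_le_mono) (auto simp: i)
        also have "\<dots> = Suc ((i' + k - 1) div (p - 1))"
          using p2 by (subst div_add_self2) auto
        finally show ?thesis .
      qed
      then have "int p ^ ((i - 1) div (p - 1)) dvd int p * int p ^ ((i' + k - 1) div (p - 1))"
        unfolding power_Suc[symmetric] by (rule le_imp_power_dvd)
      ultimately show "int p ^ ((i - 1) div (p - 1)) dvd - int (p choose k) * (diff1 ^^ (i' + k)) g y"
        unfolding mult_minus_left dvd_minus_iff by (rule dvd_trans[rotated])
    qed
    finally show ?thesis .
  qed
qed

text \<open>Newton's formula at 0 for the \<open>p\<close>-periodic indicator; its iterated
  differences are the coefficients, controlled by \<open>fleck_periodic\<close>.\<close>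

lemma indicator_dvd_expansion:
  assumes "prime p"
  obtains c :: "nat \<Rightarrow> int"
  where "\<And>i. int p ^ ((i - 1) div (p - 1)) dvd c i"
    and "\<And>y. of_bool (p dvd y) = (\<Sum>i\<le>y. c i * int (y choose i))"
proof
  let ?g = "\<lambda>y. of_bool (p dvd y) :: int"
  show "int p ^ ((i - 1) div (p - 1)) dvd (diff1 ^^ i) ?g 0" for i
    by (rule fleck_periodic[OF assms]) simp
  show "?g y = (\<Sum>i\<le>y. (diff1 ^^ i) ?g 0 * int (y choose i))" for y
    using newton_forward[of ?g 0 y] by (simp add: mult.commute)
qed

section \<open>Finite-difference degree\<close>

definition pdiff :: "'j \<Rightarrow> (('j \<Rightarrow> nat) \<Rightarrow> int) \<Rightarrow> ('j \<Rightarrow> nat) \<Rightarrow> int" where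
  "pdiff j h x = h (x(j := Suc (x j))) - h x"

text \<open>Degree means vanishing of all mixed differences of order \<open>r + 1\<close> in the
  directions \<open>J\<close>, which covers binomial coefficients without rational polynomials.
  Coordinates outside \<open>J\<close> act as parameters.\<close>

primrec deg_le :: "'j set \<Rightarrow> nat \<Rightarrow> (('j \<Rightarrow> nat) \<Rightarrow> int) \<Rightarrow> bool" where
  "deg_le J 0 h \<longleftrightarrow> (\<forall>j\<in>J. pdiff j h = (\<lambda>_. 0))"
| "deg_le J (Suc r) h \<longleftrightarrow> (\<forall>j\<in>J. deg_le J r (pdiff j h))"

lemma pdiff_const [simp]: "pdiff j (\<lambda>_. c) = (\<lambda>_. 0)"
  by (auto simp: pdiff_def)

lemma pdiff_add: "pdiff j (\<lambda>x. g x + h x) = (\<lambda>x. pdiff j g x + pdiff j h x)"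
  by (auto simp: pdiff_def)

lemma pdiff_cmult: "pdiff j (\<lambda>x. c * h x) = (\<lambda>x. c * pdiff j h x)"
  by (auto simp: pdiff_def algebra_simps)

lemma pdiff_mult:
  "pdiff j (\<lambda>x. g x * h x) =
    (\<lambda>x. pdiff j g x * h x + (g x * pdiff j h x + pdiff j g x * pdiff j h x))"
  by (auto simp: pdiff_def algebra_simps)

lemma deg_le_zero: "deg_le J r (\<lambda>_. 0)"
  by (induction r) auto

lemma deg_le_const: "deg_le J r (\<lambda>_. c)"
  by (cases r) (auto simp: deg_le_zero)

lemma deg_le_add: "deg_le J r g \<Longrightarrow> deg_le J r h \<Longrightarrow> deg_le J r (\<lambda>x. g x + h x)"
  by (induction r arbitrary: g h) (auto simp: pdiff_add)

lemma deg_le_cmult: "deg_le J r h \<Longrightarrow> deg_le J r (\<lambda>x. c * h x)"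
  by (induction r arbitrary: h) (auto simp: pdiff_cmult)

lemma deg_le_cmult_cancel: "c \<noteq> 0 \<Longrightarrow> deg_le J r (\<lambda>x. c * h x) \<Longrightarrow> deg_le J r h"
  by (induction r arbitrary: h) (auto simp: pdiff_cmult fun_eq_iff)

lemma deg_le_SucI: "deg_le J r h \<Longrightarrow> deg_le J (Suc r) h"
proof (induction r arbitrary: h)
  case 0
  then show ?case by simp
next
  case (Suc r)
  then show ?case by simp
qed

lemma deg_le_mono: "deg_le J r h \<Longrightarrow> r \<le> s \<Longrightarrow> deg_le J s h"
  by (induction s) (auto simp: le_Suc_eq dest: deg_le_SucI simp del: deg_le.simps)

text \<open>Induction on \<open>r + s\<close> through the discrete Leibniz rule
  \<open>pdiff_mult\<close>: each of its three terms contains a difference that lowers the total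
  degree.\<close>

lemma deg_le_mult:
  "deg_le J r g \<Longrightarrow> deg_le J s h \<Longrightarrow> deg_le J (r + s) (\<lambda>x. g x * h x)"
proof (induction "r + s" arbitrary: r s g h)
  case 0
  then show ?case by (auto simp: pdiff_mult fun_eq_iff)
next
  case (Suc N)
  have "deg_le J N (pdiff j (\<lambda>x. g x * h x))" if j: "j \<in> J" for j
  proof -
    have a: "deg_le J N (\<lambda>x. pdiff j g x * h x)"
    proof (cases r)
      case 0
      then have "pdiff j g = (\<lambda>_. 0)" using Suc.prems(1) j by simp
      then show ?thesis by (simp add: deg_le_zero)
    next
      case (Suc r')
      then show ?thesis using Suc.hyps(1)[of r' s "pdiff j g" h] Suc.hyps(2) Suc.prems j by auto
    qed
    have b: "deg_le J N (\<lambda>x. g x * pdiff j h x)"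
    proof (cases s)
      case 0
      then have "pdiff j h = (\<lambda>_. 0)" using Suc.prems(2) j by simp
      then show ?thesis by (simp add: deg_le_zero)
    next
      case (Suc s')
      then show ?thesis using Suc.hyps(1)[of r s' g "pdiff j h"] Suc.hyps(2) Suc.prems j by auto
    qed
    \<comment> \<open>This term even has degree \<open>r + s - 2\<close>; relaxing the bound on
      \<open>pdiff j h\<close> back to \<open>s\<close> makes the total \<open>N\<close>, as the
      induction hypothesis requires.\<close>
    have c: "deg_le J N (\<lambda>x. pdiff j g x * pdiff j h x)"
    proof (cases "r = 0 \<or> s = 0")
      case True
      then have "pdiff j g = (\<lambda>_. 0) \<or> pdiff j h = (\<lambda>_. 0)" using Suc.prems j by auto
      then show ?thesis by (auto simp: deg_le_zero)
    next
      case False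
      then obtain r' s' where "r = Suc r'" "s = Suc s'" by (metis not0_implies_Suc)
      moreover from this have "deg_le J r' (pdiff j g)" "deg_le J s (pdiff j h)"
        using Suc.prems j deg_le_SucI[of J s' "pdiff j h"] by auto
      ultimately show ?thesis using Suc.hyps(1)[of r' s "pdiff j g" "pdiff j h"] Suc.hyps(2) by simp
    qed
    show ?thesis unfolding pdiff_mult by (intro deg_le_add a b c)
  qed
  then show ?case using Suc.hyps(2)[symmetric] by simp
qed

lemma deg_le_coord: "deg_le J (Suc 0) (\<lambda>x. int (x j))"
  by (auto simp: pdiff_def fun_eq_iff)

text \<open>The product \<open>h (h - 1) \<cdots> (h - i + 1)\<close> has degree at most \<open>i D\<close>, and dividing by
  \<open>i!\<close> does not affect the vanishing of differences.\<close>
lemma deg_le_binomial: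
  assumes "deg_le J D (\<lambda>x. int (h x))"
  shows "deg_le J (i * D) (\<lambda>x. int (h x choose i))"
proof -
  have "deg_le J (i * D) (\<lambda>x. \<Prod>a<i. int (h x) - int a)"
  proof (induction i)
    case 0
    show ?case by (simp add: deg_le_const del: deg_le.simps)
  next
    case (Suc i)
    have "deg_le J D (\<lambda>x. int (h x) + - int i)"
      by (intro deg_le_add assms deg_le_const)
    from deg_le_mult[OF Suc this] show ?case by (simp add: add.commute)
  qed
  moreover have "(\<Prod>a<i. int n - int a) = fact i * int (n choose i)" for n
  proof -
    have "real_of_int (\<Prod>a<i. int n - int a) = real_of_int (fact i * int (n choose i))"
      using gbinomial_mult_fact[of i "real n"] by (simp add: binomial_gbinomial lessThan_atLeast0)
    then show ?thesis by (simp only: of_int_eq_iff)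
  qed
  ultimately have "deg_le J (i * D) (\<lambda>x. fact i * int (h x choose i))" by simp
  then show ?thesis by (rule deg_le_cmult_cancel[rotated]) simp
qed

section \<open>Iterated differences and sums over a box\<close>

lemma deg_le_funpow_pdiff:
  assumes "deg_le J r h" and "j \<in> J"
  shows "deg_le J (r - k) ((pdiff j ^^ k) h)"
proof (induction k)
  case 0
  show ?case using assms by simp
next
  case (Suc k)
  show ?case
  \<comment> \<open>Truncated subtraction is harmless: at bound 0 the next difference is the zero
    function.\<close>
  proof (cases "r - k")
    case 0
    then have "pdiff j ((pdiff j ^^ k) h) = (\<lambda>_. 0)" using Suc assms(2) by simp
    then show ?thesis by (simp add: deg_le_zero del: deg_le.simps)
  next
    case (Suc q)
    then have "r - Suc k = q" by simp
    then show ?thesis using Suc.IH Suc assms(2) by simp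
  qed
qed

lemma funpow_pdiff_eq_zero:
  assumes "deg_le J r h" and "j \<in> J" and "r < k"
  shows "(pdiff j ^^ k) h = (\<lambda>_. 0)"
proof -
  have z: "(pdiff j ^^ Suc r) h = (\<lambda>_. 0)"
    using deg_le_funpow_pdiff[OF assms(1,2), of r] assms(2) by simp
  have "(pdiff j ^^ (n + Suc r)) h = (\<lambda>_. 0)" for n
    by (induction n) (use z in auto)
  from this[of "k - Suc r"] show ?thesis using assms(3) by simp
qed

lemma pdiff_restrict:
  "i \<noteq> j \<Longrightarrow> pdiff i (\<lambda>x. h (x(j := t))) = (\<lambda>x. pdiff i h (x(j := t)))"
  by (simp add: pdiff_def fun_upd_twist fun_eq_iff)

text \<open>Freezing coordinate \<open>j\<close> commutes with differences in other directions; this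
  lets \<open>box_sum_dvd\<close> remove one coordinate at a time.\<close>

lemma deg_le_restrict:
  assumes "deg_le (insert j J) r h" and "j \<notin> J"
  shows "deg_le J r (\<lambda>x. h (x(j := t)))"
  using assms(1)
proof (induction r arbitrary: h)
  case 0
  have "pdiff i (\<lambda>x. h (x(j := t))) = (\<lambda>_. 0)" if "i \<in> J" for i
    using 0 that assms(2) by (subst pdiff_restrict) auto
  then show ?case unfolding deg_le.simps by blast
next
  case (Suc r)
  have "deg_le J r (pdiff i (\<lambda>x. h (x(j := t))))" if "i \<in> J" for i
    using Suc.prems that assms(2) by (subst pdiff_restrict) (auto intro!: Suc.IH)
  then show ?case unfolding deg_le.simps by blast
qed

lemma funpow_pdiff_line: "(pdiff j ^^ k) h (x(j := t)) = (diff1 ^^ k) (\<lambda>t. h (x(j := t))) t"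
  by (induction k arbitrary: t) (auto simp: pdiff_def diff1_def)

lemma sum_PiE_insert:
  assumes "j \<notin> J"
  shows "(\<Sum>x\<in>insert j J \<rightarrow>\<^sub>E T. h x) = (\<Sum>x\<in>J \<rightarrow>\<^sub>E T. \<Sum>t\<in>T. h (x(j := t)))"
proof -
  have "(\<Sum>x\<in>insert j J \<rightarrow>\<^sub>E T. h x) = (\<Sum>(t, x)\<in>T \<times> (J \<rightarrow>\<^sub>E T). h (x(j := t)))"
    unfolding PiE_insert_eq by (subst sum.reindex[OF inj_combinator[OF assms]]) (auto simp: case_prod_unfold)
  also have "\<dots> = (\<Sum>t\<in>T. \<Sum>x\<in>J \<rightarrow>\<^sub>E T. h (x(j := t)))"
    by (rule sum.cartesian_product[symmetric])
  also have "\<dots> = (\<Sum>x\<in>J \<rightarrow>\<^sub>E T. \<Sum>t\<in>T. h (x(j := t)))" by (rule sum.swap)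
  finally show ?thesis .
qed

text \<open>Summing one coordinate over \<open>{..<p}\<close> gives \<open>\<Sum>k<p. (p choose (k + 1)) \<Delta>^k\<close>: each
  coefficient is divisible by \<open>p\<close> except that of \<open>\<Delta>^(p - 1)\<close>, which lowers the degree
  by \<open>p - 1\<close>.\<close>
lemma box_sum_dvd:
  assumes "prime p" and "finite J" and "deg_le J r h"
  shows "int p ^ (card J - r div (p - 1)) dvd (\<Sum>x\<in>J \<rightarrow>\<^sub>E {..<p}. h x)"
  using assms(2,3)
proof (induction J arbitrary: r h rule: finite_induct)
  case empty
  show ?case by simp
next
  case (insert j J)
  have p2: "p \<ge> 2" using assms(1) by (simp add: prime_ge_2_nat)
  \<comment> \<open>Newton's formula in coordinate \<open>j\<close>, based at 0, leaves these sums
    over the smaller box, of functions of degree at most \<open>r - k\<close>.\<close>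
  let ?S = "\<lambda>k. \<Sum>x\<in>J \<rightarrow>\<^sub>E {..<p}. (pdiff j ^^ k) h (x(j := 0))"
  have S: "int p ^ (card J - (r - k) div (p - 1)) dvd ?S k" for k
    using deg_le_funpow_pdiff[OF insert.prems, of j k] insert.hyps(2)
    by (intro insert.IH deg_le_restrict) auto
  have "(\<Sum>x\<in>insert j J \<rightarrow>\<^sub>E {..<p}. h x)
      = (\<Sum>x\<in>J \<rightarrow>\<^sub>E {..<p}. \<Sum>k<p. int (p choose Suc k) * (pdiff j ^^ k) h (x(j := 0)))"
    unfolding sum_PiE_insert[OF insert.hyps(2)] funpow_pdiff_line
    by (intro sum.cong refl sum_newton_forward)
  also have "\<dots> = (\<Sum>k<p. int (p choose Suc k) * ?S k)"
    unfolding sum_distrib_left by (rule sum.swap)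
  also have "int p ^ (card (insert j J) - r div (p - 1)) dvd \<dots>"
  proof (rule dvd_sum)
    fix k assume k: "k \<in> {..<p}"
    show "int p ^ (card (insert j J) - r div (p - 1)) dvd int (p choose Suc k) * ?S k"
    proof (cases "k = p - 1")
      case False
      then have "int p dvd int (p choose Suc k)"
        using k assms(1) by (auto simp: dvd_choose_prime)
      moreover have "int p ^ (card J - r div (p - 1)) dvd ?S k"
      proof -
        have "(r - k) div (p - 1) \<le> r div (p - 1)" by (intro div_le_mono) simp
        then show ?thesis
          by (intro dvd_trans[OF le_imp_power_dvd S[of k]] diff_le_mono2)
      qed
      ultimately have "int p * int p ^ (card J - r div (p - 1)) dvd int (p choose Suc k) * ?S k"
        by (rule mult_dvd_mono)
      moreover have "card (insert j J) - r div (p - 1) \<le> Suc (card J - r div (p - 1))"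
        using insert.hyps by simp
      ultimately show ?thesis
        unfolding power_Suc[symmetric] by (blast intro: dvd_trans le_imp_power_dvd)
    next
      case k: True
      show ?thesis
      \<comment> \<open>Here the coefficient is \<open>p choose p = 1\<close>. For
        \<open>r < p - 1\<close> the difference vanishes; otherwise the degree bound falls by
        \<open>p - 1\<close> and the quotient by one.\<close>
      proof (cases "r < p - 1")
        case True
        then have "(pdiff j ^^ k) h = (\<lambda>_. 0)"
          using funpow_pdiff_eq_zero[OF insert.prems, of j k] k by simp
        then show ?thesis by simp
      next
        case False
        then have "r div (p - 1) = Suc ((r - (p - 1)) div (p - 1))"
          using p2 by (simp add: le_div_geq)
        then have "card (insert j J) - r div (p - 1) = card J - (r - (p - 1)) div (p - 1)"
          using insert.hyps by simp
        then show ?thesis using S[of k] k by (simp add: dvd_mult)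
      qed
    qed
  qed
  finally show ?case .
qed

section \<open>Weighted sums of functions of bounded degree\<close>

text \<open>A summand \<open>p^a h\<close> may have degree up to \<open>a (p - 1) D\<close> above the nominal weight
  \<open>s\<close>: the factor \<open>p^a\<close> pays for the excess.\<close>
inductive weighted :: "nat \<Rightarrow> 'j set \<Rightarrow> nat \<Rightarrow> nat \<Rightarrow> (('j \<Rightarrow> nat) \<Rightarrow> int) \<Rightarrow> bool"
  for p J D s where
  base: "deg_le J r h \<Longrightarrow> r \<le> s + a * ((p - 1) * D) \<Longrightarrow> weighted p J D s (\<lambda>x. int p ^ a * h x)"
| add: "weighted p J D s g \<Longrightarrow> weighted p J D s h \<Longrightarrow> weighted p J D s (\<lambda>x. g x + h x)"

lemma weighted_const: "weighted p J D s (\<lambda>_. c)"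
  using weighted.base[of J 0 "\<lambda>_. c" s 0 p D] by (simp add: deg_le_const del: deg_le.simps)

lemma weighted_sum:
  "(\<And>i. i \<in> I \<Longrightarrow> weighted p J D s (h i)) \<Longrightarrow> weighted p J D s (\<lambda>x. \<Sum>i\<in>I. h i x)"
  by (induction I rule: infinite_finite_induct) (auto intro: weighted.add weighted_const)

lemma weighted_mult:
  assumes "weighted p J D s g" and "weighted p J D t h"
  shows "weighted p J D (s + t) (\<lambda>x. g x * h x)"
  using assms(1)
proof induction
  case (base r g a)
  note g = base
  show ?case
    using assms(2)
  proof induction
    case (base r' h a')
    have "r + r' \<le> (s + t) + (a + a') * ((p - 1) * D)"
      using g(2) base(2) unfolding add_mult_distrib by linarith
    then have "weighted p J D (s + t) (\<lambda>x. int p ^ (a + a') * (g x * h x))"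
      by (rule weighted.base[OF deg_le_mult[OF g(1) base(1)]])
    then show ?case by (simp add: power_add mult_ac)
  next
    case (add h h')
    from weighted.add[OF add.IH] show ?case by (simp add: algebra_simps)
  qed
next
  case (add g g')
  from weighted.add[OF add.IH] show ?case by (simp add: algebra_simps)
qed

lemma weighted_prod:
  assumes "finite I" and "\<And>i. i \<in> I \<Longrightarrow> weighted p J D s (h i)"
  shows "weighted p J D (card I * s) (\<lambda>x. \<Prod>i\<in>I. h i x)"
  using assms
proof (induction I rule: finite_induct)
  case empty
  show ?case by (simp add: weighted_const)
next
  case (insert i I)
  then show ?case using weighted_mult[of p J D s "h i" "card I * s"] by simp
qed

text \<open>Besides the explicit \<open>p^a\<close>, a summand of degree \<open>r\<close> gains
  \<open>card J - r div (p - 1)\<close> factors from \<open>box_sum_dvd\<close>, with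
  \<open>r div (p - 1) \<le> (s + a) * D\<close>. The assumption \<open>v\<close> keeps
  \<open>v\<close> at most the ceiling of \<open>card J / D\<close>.\<close>

lemma weighted_box_sum_dvd:
  assumes "prime p" and "finite J" and "weighted p J D (s * ((p - 1) * D)) h"
    and v: "(v - 1) * D < card J" and "D \<ge> 1"
  shows "int p ^ (v - s) dvd (\<Sum>x\<in>J \<rightarrow>\<^sub>E {..<p}. h x)"
  using assms(3)
proof induction
  case (base r h a)
  have p1: "p - 1 > 0" using prime_gt_1_nat[OF assms(1)] by simp
  have "r \<le> (s + a) * D * (p - 1)"
    using base(2) by (simp add: algebra_simps)
  then have "r div (p - 1) \<le> (s + a) * D * (p - 1) div (p - 1)"
    by (rule div_le_mono)
  then have r: "r div (p - 1) \<le> (s + a) * D" using p1 by simp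
  have "v - s \<le> a + (card J - r div (p - 1))"
  proof (cases "v \<le> s + a")
    case False
    then obtain w where w: "v - 1 = s + a + w" and "v = Suc (s + a + w)"
      by (metis add_Suc diff_Suc_1 less_imp_Suc_add not_le)
    have "w \<le> w * D" using assms(5) by simp
    moreover have "(s + a) * D + w * D < card J" using v unfolding w by (simp only: add_mult_distrib)
    ultimately have "(s + a) * D + w < card J" by linarith
    then show ?thesis using r w False by linarith
  qed simp
  then have "int p ^ (v - s) dvd int p ^ a * int p ^ (card J - r div (p - 1))"
    unfolding power_add[symmetric] by (rule le_imp_power_dvd)
  also have "\<dots> dvd int p ^ a * (\<Sum>x\<in>J \<rightarrow>\<^sub>E {..<p}. h x)"
    by (intro mult_dvd_mono dvd_refl box_sum_dvd assms base)
  finally show ?case by (simp add: sum_distrib_left)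
next
  case (add g h)
  then show ?case by (simp add: sum.distrib)
qed

text \<open>Term \<open>i\<close> of the expansion has degree at most \<open>i * D\<close>, and
  \<open>i \<le> (p - 1) * (a + 1)\<close> where \<open>p^a\<close> divides its coefficient, so it
  fits weight \<open>(p - 1) * D\<close>.\<close>

lemma weighted_indicator:
  assumes "prime p" and "finite X" and "deg_le J D (\<lambda>x. int (h x))"
  obtains g where "weighted p J D ((p - 1) * D) g"
    and "\<And>x. x \<in> X \<Longrightarrow> g x = of_bool (p dvd h x)"
proof -
  obtain c where c: "\<And>i. int p ^ ((i - 1) div (p - 1)) dvd c i"
    "\<And>y. of_bool (p dvd y) = (\<Sum>i\<le>y. c i * int (y choose i))"
    using indicator_dvd_expansion[OF assms(1)] by metis
  have p1: "p - 1 > 0" using prime_gt_1_nat[OF assms(1)] by simp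
  \<comment> \<open>The expansion stops at \<open>h x\<close>, which depends on \<open>x\<close>.
    \<open>B\<close> is a common cutoff on \<open>X\<close>: the extra binomials
    \<open>h x choose i\<close> with \<open>i > h x\<close> are 0.\<close>
  define B where "B = (\<Sum>x\<in>X. h x)"
  let ?g = "\<lambda>x. \<Sum>i\<le>B. c i * int (h x choose i)"
  have "weighted p J D ((p - 1) * D) ?g"
  proof (rule weighted_sum)
    fix i
    define a where "a = (i - 1) div (p - 1)"
    obtain c' where c': "c i = int p ^ a * c'" using c(1)[of i] unfolding a_def by (auto elim: dvdE)
    have "i \<le> (p - 1) * (a + 1)"
    proof -
      have "i - 1 < (p - 1) * (a + 1)"
        unfolding a_def using dividend_less_times_div[OF p1, of "i - 1"] by (simp add: algebra_simps)
      then show ?thesis by linarith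
    qed
    then have "i * D \<le> (p - 1) * (a + 1) * D" by (rule mult_le_mono1)
    then have "i * D \<le> (p - 1) * D + a * ((p - 1) * D)" by (simp add: algebra_simps)
    from weighted.base[OF deg_le_cmult[OF deg_le_binomial[OF assms(3)]] this, of c']
    show "weighted p J D ((p - 1) * D) (\<lambda>x. c i * int (h x choose i))"
      by (simp add: c' mult_ac)
  qed
  moreover have "?g x = of_bool (p dvd h x)" if "x \<in> X" for x
  proof -
    have "h x \<le> B" unfolding B_def using assms(2) that by (simp add: member_le_sum)
    then have "?g x = (\<Sum>i\<le>h x. c i * int (h x choose i))"
      by (intro sum.mono_neutral_right) (auto simp: not_le)
    then show ?thesis using c(2) by simp
  qed
  ultimately show thesis by (rule that)
qed

section \<open>Lifting maps into a ring of prime characteristic\<close>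

text \<open>In characteristic \<open>p\<close> these are the linear functionals over the prime
  field, with values represented by naturals.\<close>

definition mod_additive :: "nat \<Rightarrow> ('a::plus \<Rightarrow> nat) \<Rightarrow> bool" where
  "mod_additive p l \<longleftrightarrow> (\<forall>a b. [l (a + b) = l a + l b] (mod p))"

text \<open>All functionals are quantified over, not just the coordinates in one basis:
  multiplication by a constant \<open>c\<close> is then absorbed by replacing \<open>l\<close> with
  \<open>\<lambda>a. l (c * a)\<close>.\<close>

definition liftable :: "nat \<Rightarrow> 'j set \<Rightarrow> nat \<Rightarrow> (('j \<Rightarrow> nat) \<Rightarrow> 'a::comm_ring_1) \<Rightarrow> bool" where
  "liftable p J D F \<longleftrightarrow> (\<forall>l. mod_additive p l \<longrightarrow>
     (\<exists>h. deg_le J D (\<lambda>x. int (h x)) \<and> (\<forall>x. [l (F x) = h x] (mod p))))"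

lemma mod_additive_add: "mod_additive p l \<Longrightarrow> [l (a + b) = l a + l b] (mod p)"
  by (simp add: mod_additive_def)

lemma mod_additive_zero: "mod_additive p (l :: 'a::comm_ring_1 \<Rightarrow> nat) \<Longrightarrow> [l 0 = 0] (mod p)"
  using mod_additive_add[of p l 0 0] cong_add_lcancel_0_nat[of "l 0" "l 0" p] by (simp add: cong_sym_eq)

lemma mod_additive_of_nat_mult:
  "mod_additive p (l :: 'a::comm_ring_1 \<Rightarrow> nat) \<Longrightarrow> [l (of_nat n * a) = n * l a] (mod p)"
proof (induction n)
  case 0
  then show ?case using mod_additive_zero by simp
next
  case (Suc n)
  have "[l (of_nat (Suc n) * a) = l a + l (of_nat n * a)] (mod p)"
    using mod_additive_add[OF Suc.prems, of a "of_nat n * a"] by (simp add: algebra_simps)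
  also have "[l a + l (of_nat n * a) = l a + n * l a] (mod p)"
    using Suc by (intro cong_add cong_refl) auto
  finally show ?case by simp
qed

lemma liftable_const: "liftable p J D (\<lambda>_. c)"
  unfolding liftable_def
proof (intro allI impI)
  fix l :: "'b \<Rightarrow> nat"
  show "\<exists>h. deg_le J D (\<lambda>x. int (h x)) \<and> (\<forall>x. [l c = h x] (mod p))"
    by (intro exI[of _ "\<lambda>_. l c"]) (simp add: deg_le_const)
qed

lemma liftable_add:
  assumes "liftable p J D F" and "liftable p J D G"
  shows "liftable p J D (\<lambda>x. F x + G x)"
  unfolding liftable_def
proof (intro allI impI)
  fix l :: "'b \<Rightarrow> nat" assume l: "mod_additive p l"
  obtain h where h: "deg_le J D (\<lambda>x. int (h x))" "\<And>x. [l (F x) = h x] (mod p)"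
    using assms(1) l unfolding liftable_def by blast
  obtain h' where h': "deg_le J D (\<lambda>x. int (h' x))" "\<And>x. [l (G x) = h' x] (mod p)"
    using assms(2) l unfolding liftable_def by blast
  have "deg_le J D (\<lambda>x. int (h x + h' x))" using deg_le_add[OF h(1) h'(1)] by simp
  moreover have "[l (F x + G x) = h x + h' x] (mod p)" for x
    using mod_additive_add[OF l] cong_add[OF h(2) h'(2)] cong_trans by blast
  ultimately show "\<exists>h. deg_le J D (\<lambda>x. int (h x)) \<and> (\<forall>x. [l (F x + G x) = h x] (mod p))"
    by (intro exI[of _ "\<lambda>x. h x + h' x"]) simp
qed

lemma liftable_sum:
  "(\<And>i. i \<in> I \<Longrightarrow> liftable p J D (F i)) \<Longrightarrow> liftable p J D (\<lambda>x. \<Sum>i\<in>I. F i x)"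
  by (induction I rule: infinite_finite_induct) (auto intro: liftable_add liftable_const)

lemma liftable_mono:
  assumes "liftable p J D F" and "D \<le> D'" shows "liftable p J D' F"
  using assms deg_le_mono unfolding liftable_def by metis

lemma liftable_cmult:
  assumes "liftable p J D F"
  shows "liftable p J D (\<lambda>x. c * F x)"
  unfolding liftable_def
proof (intro allI impI)
  fix l :: "'b \<Rightarrow> nat" assume "mod_additive p l"
  then have "mod_additive p (\<lambda>a. l (c * a))"
    by (simp add: mod_additive_def distrib_left)
  then show "\<exists>h. deg_le J D (\<lambda>x. int (h x)) \<and> (\<forall>x. [l (c * F x) = h x] (mod p))"
    using assms unfolding liftable_def by blast
qed

text \<open>The factor \<open>of_nat (x j)\<close> stands for a repeated sum and leaves
  \<open>l\<close> as the integer \<open>x j\<close>, a function of degree one.\<close>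

lemma liftable_mult_coord:
  assumes "liftable p J D F"
  shows "liftable p J (Suc D) (\<lambda>x. F x * of_nat (x j))"
  unfolding liftable_def
proof (intro allI impI)
  fix l :: "'b \<Rightarrow> nat" assume l: "mod_additive p l"
  obtain h where h: "deg_le J D (\<lambda>x. int (h x))" "\<And>x. [l (F x) = h x] (mod p)"
    using assms l unfolding liftable_def by blast
  have "deg_le J (Suc D) (\<lambda>x. int (h x * x j))"
    using deg_le_mult[OF h(1) deg_le_coord[of J j]] by simp
  moreover have "[l (F x * of_nat (x j)) = h x * x j] (mod p)" for x
  proof -
    have "[l (of_nat (x j) * F x) = x j * l (F x)] (mod p)"
      by (rule mod_additive_of_nat_mult[OF l])
    also have "[x j * l (F x) = x j * h x] (mod p)" by (intro cong_mult cong_refl h)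
    finally show ?thesis by (simp add: mult.commute)
  qed
  ultimately show "\<exists>h. deg_le J (Suc D) (\<lambda>x. int (h x)) \<and> (\<forall>x. [l (F x * of_nat (x j)) = h x] (mod p))"
    by (intro exI[of _ "\<lambda>x. h x * x j"]) simp
qed

lemma liftable_mult_linear:
  assumes "liftable p J D F"
  shows "liftable p J (Suc D) (\<lambda>x. F x * (\<Sum>j\<in>I. of_nat (x j) * v j))"
proof -
  have "liftable p J (Suc D) (\<lambda>x. \<Sum>j\<in>I. v j * (F x * of_nat (x j)))"
    by (intro liftable_sum liftable_cmult liftable_mult_coord assms)
  then show ?thesis by (simp add: sum_distrib_left mult_ac)
qed

lemma liftable_mult_linear_power:
  assumes "liftable p J D F"
  shows "liftable p J (D + n) (\<lambda>x. F x * (\<Sum>j\<in>I. of_nat (x j) * v j) ^ n)"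
proof (induction n)
  case 0
  show ?case using assms by simp
next
  case (Suc n)
  from liftable_mult_linear[OF this] show ?case by (simp add: mult_ac)
qed

section \<open>Frobenius and powers of linear forms\<close>

lemma of_nat_power_CHAR:
  assumes "prime CHAR('a::comm_ring_1)"
  shows "(of_nat n :: 'a) ^ CHAR('a) = of_nat n"
proof (induction n)
  case 0
  show ?case using prime_gt_0_nat[OF assms] by (simp add: power_0_left)
next
  case (Suc n)
  then show ?case using freshmans_dream[OF assms refl, of 1 "of_nat n"] by simp
qed

text \<open>The Frobenius map sends a linear form to a linear form, so only the base-\<open>p\<close> digits of
  the exponent contribute to the degree.\<close>
lemma liftable_mult_linear_power_digits:
  fixes v :: "'j \<Rightarrow> 'a::comm_ring_1"
  assumes "prime CHAR('a)" and "p = CHAR('a)" and "liftable p J D F"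
  shows "liftable p J (D + digit_sum p t) (\<lambda>x. F x * (\<Sum>j\<in>I. of_nat (x j) * v j) ^ t)"
  using assms(3)
proof (induction t arbitrary: D F v rule: less_induct)
  case (less t)
  have p2: "p \<ge> 2" using assms by (simp add: prime_ge_2_nat)
  show ?case
  proof (cases "t = 0")
    case True
    then show ?thesis using liftable_mono[OF less.prems, of "D + digit_sum p t"]
      by (simp del: digit_sum.simps)
  next
    case False
    let ?L = "\<lambda>v x. \<Sum>j\<in>I. of_nat (x j) * v j :: 'a"
    \<comment> \<open>Frobenius fixes the integer coordinates \<open>x j\<close> and acts only on
      the coefficients \<open>v j\<close>.\<close>
    have frob: "?L v x ^ p = ?L (\<lambda>j. v j ^ p) x" for x
      by (simp add: assms(2) freshmans_dream_sum[OF assms(1) refl]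
          of_nat_power_CHAR[OF assms(1)] power_mult_distrib)
    \<comment> \<open>The lowest digit of \<open>t\<close> costs that many linear factors; the rest
      is again a power of a linear form.\<close>
    have "?L v x ^ t = ?L v x ^ (t mod p) * ?L (\<lambda>j. v j ^ p) x ^ (t div p)" for x
      by (simp flip: frob power_mult power_add)
    moreover have "liftable p J (D + t mod p + digit_sum p (t div p))
        (\<lambda>x. F x * ?L v x ^ (t mod p) * ?L (\<lambda>j. v j ^ p) x ^ (t div p))"
      using False p2 by (intro less.IH liftable_mult_linear_power less.prems) auto
    moreover have "digit_sum p t = t mod p + digit_sum p (t div p)"
      using False p2 by (subst digit_sum.simps) simp
    ultimately show ?thesis by (simp add: mult_ac add_ac del: digit_sum.simps)
  qed
qed

lemma liftable_prod_linear_power: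
  fixes v :: "'i \<Rightarrow> 'j \<Rightarrow> 'a::comm_ring_1"
  assumes "prime CHAR('a)" and "p = CHAR('a)" and "finite S"
  shows "liftable p J (\<Sum>i\<in>S. digit_sum p (t i)) (\<lambda>x. \<Prod>i\<in>S. (\<Sum>j\<in>I i. of_nat (x j) * v i j) ^ t i)"
  using assms(3)
proof (induction S rule: finite_induct)
  case empty
  show ?case by (simp add: liftable_const)
next
  case (insert i S)
  from liftable_mult_linear_power_digits[OF assms(1,2) this(3), of "t i" "v i" "I i"] insert.hyps
  show ?case by (simp add: add_ac mult_ac del: digit_sum.simps)
qed

section \<open>Coordinates relative to a subgroup\<close>

lemma of_nat_mult_mem:
  fixes H :: "'a::comm_ring_1 set"
  assumes "0 \<in> H" and "\<And>x y. x \<in> H \<Longrightarrow> y \<in> H \<Longrightarrow> x + y \<in> H" and "x \<in> H"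
  shows "of_nat n * x \<in> H"
  by (induction n) (use assms in \<open>auto simp: distrib_right\<close>)

lemma of_nat_cong_CHAR:
  assumes "[m = n] (mod CHAR('a::comm_ring_1))"
  shows "(of_nat m :: 'a) = of_nat n"
  using assms of_nat_eq_iff_cong_CHAR by blast

text \<open>If \<open>m < n\<close>, then \<open>of_nat (n - m) * b\<close> lies in
  \<open>H\<close>; as \<open>n - m\<close> is invertible modulo \<open>p\<close>, so does
  \<open>b\<close>.\<close>

lemma coset_coefficient_unique:
  fixes H :: "'a::comm_ring_1 set"
  assumes p: "prime CHAR('a)" "p = CHAR('a)"
    and H: "0 \<in> H" "\<And>x y. x \<in> H \<Longrightarrow> y \<in> H \<Longrightarrow> x + y \<in> H"
    and "b \<notin> H" and "h \<in> H" "h' \<in> H" and "m < p" "n < p"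
    and "h + of_nat m * b = h' + of_nat n * b"
  shows "m = n"
proof -
  have minus: "x - y \<in> H" if "x \<in> H" "y \<in> H" for x y
  proof -
    have "of_nat (p - 1) * y = - y"
    proof -
      have "(of_nat (p - 1) + 1) * y = of_nat p * y"
        using prime_gt_0_nat[OF p(1)] p(2) by (simp add: of_nat_diff)
      also have "\<dots> = 0" using p(2) by simp
      finally show ?thesis by (simp add: distrib_right eq_neg_iff_add_eq_0)
    qed
    then show ?thesis using of_nat_mult_mem[OF H that(2), of "p - 1"] H(2)[OF that(1), of "- y"]
      by simp
  qed
  have False
    if less: "m < n" and mem: "h \<in> H" "h' \<in> H" and "n < p"
      and eq: "h + of_nat m * b = h' + of_nat n * b" for m n h h'
  proof -
    have "of_nat (n - m) * b = h - h'"
      using eq less by (simp add: of_nat_diff algebra_simps)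
    then have *: "of_nat (n - m) * b \<in> H" using minus mem by simp
    have "coprime (n - m) p"
    proof (rule coprime_commute[THEN iffD1], rule prime_imp_coprime)
      show "prime p" using p by simp
      show "\<not> p dvd n - m" using less \<open>n < p\<close> by (intro nat_dvd_not_less) auto
    qed
    then obtain u where "[(n - m) * u = 1] (mod p)" using cong_solve_coprime_nat by auto
    then have "of_nat ((n - m) * u) = (of_nat 1 :: 'a)"
      unfolding p(2) by (rule of_nat_cong_CHAR)
    then have "of_nat u * of_nat (n - m) = (1 :: 'a)" by (simp add: mult.commute)
    then have "b = of_nat u * (of_nat (n - m) * b)" by (simp only: mult.assoc[symmetric] mult_1_left)
    then show False using of_nat_mult_mem[OF H *, of u] \<open>b \<notin> H\<close> by metis
  qed
  note no_less = this
  show ?thesis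
  proof (cases m n rule: linorder_cases)
    case less
    from no_less[OF this assms(6,7,9,10)] show ?thesis ..
  next
    case greater
    from no_less[OF this assms(7,6,8) assms(10)[symmetric]] show ?thesis ..
  qed
qed

text \<open>\<open>H\<close> is a subspace over the prime field and \<open>b\<close> a basis of a
  complement. The induction adjoins one vector outside \<open>H\<close> at a time.\<close>

lemma complement_basis:
  fixes H :: "'a::{finite,comm_ring_1} set"
  assumes p: "prime CHAR('a)" "p = CHAR('a)"
    and "0 \<in> H" "\<And>x y. x \<in> H \<Longrightarrow> y \<in> H \<Longrightarrow> x + y \<in> H"
  shows "\<exists>(s :: nat) b. bij_betw (\<lambda>(h, c). h + (\<Sum>i<s. of_nat (c i) * b i))
           (H \<times> ({..<s} \<rightarrow>\<^sub>E {..<p})) UNIV"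
  using assms(3,4)
proof (induction "card (UNIV - H)" arbitrary: H rule: less_induct)
  case less
  note H = less.prems
  show ?case
  proof (cases "H = UNIV")
    case True
    then have "bij_betw (\<lambda>(h, c). h + (\<Sum>i<0::nat. of_nat (c i) * (0 :: 'a))) (H \<times> ({..<0} \<rightarrow>\<^sub>E {..<p})) UNIV"
      by (auto simp: bij_betw_def inj_on_def)
    then show ?thesis by - (rule exI[of _ 0], rule exI[of _ "\<lambda>_. 0"], assumption)
  next
    case False
    then obtain b0 where b0: "b0 \<notin> H" by blast
    define H' where "H' = {h + of_nat c * b0 | h c. h \<in> H \<and> c < p}"
    have p2: "p \<ge> 2" using p by (simp add: prime_ge_2_nat)
    have in_H': "h + of_nat n * b0 \<in> H'" if "h \<in> H" for h n
    proof -
      have "(of_nat n :: 'a) = of_nat (n mod p)"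
        using p by (intro of_nat_cong_CHAR) (simp add: cong_def)
      then show ?thesis unfolding H'_def using that p2 by fastforce
    qed
    have add: "x + y \<in> H'" if xy: "x \<in> H'" "y \<in> H'" for x y
    proof -
      obtain h c where x: "x = h + of_nat c * b0" "h \<in> H"
        using xy(1) unfolding H'_def by blast
      obtain h' c' where y: "y = h' + of_nat c' * b0" "h' \<in> H"
        using xy(2) unfolding H'_def by blast
      have "x + y = (h + h') + of_nat (c + c') * b0" by (simp add: x y algebra_simps)
      then show ?thesis using in_H'[OF H(2)[OF x(2) y(2)], of "c + c'"] by simp
    qed
    have "H \<subseteq> H'" using in_H'[of _ 0] by auto
    moreover have "b0 \<in> H'" using in_H'[OF H(1), of 1] by simp
    ultimately have "card (UNIV - H') < card (UNIV - H)"
      using b0 by (intro psubset_card_mono) auto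
    from less.hyps[OF this] \<open>H \<subseteq> H'\<close> H(1) add
    obtain s :: nat and b where bij: "bij_betw (\<lambda>(h, c). h + (\<Sum>i<s. of_nat (c i) * b i))
        (H' \<times> ({..<s} \<rightarrow>\<^sub>E {..<p})) UNIV" by blast
    \<comment> \<open>\<open>b0\<close> takes the new last index \<open>s\<close>; \<open>?T\<close>
      moves that coordinate into the \<open>H'\<close> component, so \<open>?g\<close> factors
      through the old bijection \<open>?f\<close>.\<close>
    define b' where "b' = b(s := b0)"
    let ?f = "\<lambda>(h, c). h + (\<Sum>i<s. of_nat (c i) * b i)"
    let ?g = "\<lambda>(h, c). h + (\<Sum>i<Suc s. of_nat (c i) * b' i)"
    let ?T = "\<lambda>(h, c). (h + of_nat (c s) * b0, restrict c {..<s})"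
    have g: "?g x = ?f (?T x)" for x
      by (simp add: b'_def split_beta algebra_simps)
    have T: "?T x \<in> H' \<times> ({..<s} \<rightarrow>\<^sub>E {..<p})" if "x \<in> H \<times> ({..<Suc s} \<rightarrow>\<^sub>E {..<p})" for x
      using that in_H' by (auto simp: PiE_iff)
    have injT: "inj_on ?T (H \<times> ({..<Suc s} \<rightarrow>\<^sub>E {..<p}))"
    proof (rule inj_onI, clarify)
      fix h c h' c'
      assume h: "h \<in> H" "h' \<in> H" and c: "c \<in> {..<Suc s} \<rightarrow>\<^sub>E {..<p}" "c' \<in> {..<Suc s} \<rightarrow>\<^sub>E {..<p}"
        and eq: "h + of_nat (c s) * b0 = h' + of_nat (c' s) * b0"
        and r: "restrict c {..<s} = restrict c' {..<s}"
      have "c s = c' s"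
        using c by (intro coset_coefficient_unique[OF p H b0 h _ _ eq]) (auto simp: PiE_iff)
      moreover have "c i = c' i" if "i < s" for i
        using fun_cong[OF r, of i] that by simp
      ultimately have "c = c'" using c by (intro PiE_ext[OF c]) (auto simp: less_Suc_eq)
      then show "h = h' \<and> c = c'" using eq by simp
    qed
    have "inj_on ?g (H \<times> ({..<Suc s} \<rightarrow>\<^sub>E {..<p}))"
    proof (rule inj_onI)
      fix x y
      assume x: "x \<in> H \<times> ({..<Suc s} \<rightarrow>\<^sub>E {..<p})" and y: "y \<in> H \<times> ({..<Suc s} \<rightarrow>\<^sub>E {..<p})"
        and "?g x = ?g y"
      then have "?f (?T x) = ?f (?T y)" by (simp only: g)
      then have "?T x = ?T y" by (rule inj_onD[OF bij_betw_imp_inj_on[OF bij] _ T[OF x] T[OF y]])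
      then show "x = y" by (rule inj_onD[OF injT _ x y])
    qed
    moreover have "?g ` (H \<times> ({..<Suc s} \<rightarrow>\<^sub>E {..<p})) = UNIV"
    proof -
      have "z \<in> ?g ` (H \<times> ({..<Suc s} \<rightarrow>\<^sub>E {..<p}))" for z
      proof -
        have "z \<in> ?f ` (H' \<times> ({..<s} \<rightarrow>\<^sub>E {..<p}))" using bij by (simp add: bij_betw_def)
        then obtain y c where y: "y \<in> H'" and c: "c \<in> {..<s} \<rightarrow>\<^sub>E {..<p}" and z: "z = ?f (y, c)"
          by blast
        obtain h n where h: "h \<in> H" "n < p" "y = h + of_nat n * b0" using y unfolding H'_def by blast
        have "restrict (c(s := n)) {..<s} = c"
          using c by (auto simp: PiE_iff extensional_def restrict_def)
        then have "?T (h, c(s := n)) = (y, c)" by (simp add: h)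
        then have "z = ?g (h, c(s := n))" by (simp only: g z)
        moreover have "(h, c(s := n)) \<in> H \<times> ({..<Suc s} \<rightarrow>\<^sub>E {..<p})"
          using h c by (auto simp: PiE_iff extensional_def less_Suc_eq)
        ultimately show ?thesis by blast
      qed
      then show ?thesis by blast
    qed
    ultimately show ?thesis unfolding bij_betw_def by blast
  qed
qed

lemma prime_char_basis:
  fixes p :: nat
  assumes "prime CHAR('a::{finite,comm_ring_1})" and "p = CHAR('a)"
  obtains s and b :: "nat \<Rightarrow> 'a::{finite,comm_ring_1}"
  where "bij_betw (\<lambda>c. \<Sum>i<s. of_nat (c i) * b i) ({..<s} \<rightarrow>\<^sub>E {..<p}) UNIV"
    and "card (UNIV :: 'a set) = p ^ s"
proof -
  obtain s and b :: "nat \<Rightarrow> 'a" where bij: "bij_betw (\<lambda>(h, c). h + (\<Sum>i<s. of_nat (c i) * b i))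
           ({0} \<times> ({..<s} \<rightarrow>\<^sub>E {..<p})) UNIV"
    using complement_basis[OF assms, of "{0}"] by auto
  have "bij_betw (Pair (0 :: 'a)) X ({0} \<times> X)" for X :: "(nat \<Rightarrow> nat) set"
    by (auto simp: bij_betw_def inj_on_def)
  from bij_betw_trans[OF this bij]
  have *: "bij_betw (\<lambda>c. \<Sum>i<s. of_nat (c i) * b i) ({..<s} \<rightarrow>\<^sub>E {..<p}) UNIV"
    by (simp add: comp_def)
  then have "card (UNIV :: 'a set) = p ^ s"
    by (simp add: bij_betw_same_card[symmetric] card_PiE)
  with * show thesis by (rule that)
qed

text \<open>The coordinates along a complement of \<open>H\<close> are functionals that vanish
  together exactly on \<open>H\<close>; \<open>s\<close> is its codimension.\<close>

lemma subgroup_coordinates: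
  fixes H :: "'a::{finite,comm_ring_1} set"
  assumes p: "prime CHAR('a)" "p = CHAR('a)"
    and H: "0 \<in> H" "\<And>x y. x \<in> H \<Longrightarrow> y \<in> H \<Longrightarrow> x + y \<in> H"
  obtains s :: nat and l where "\<And>i. i < s \<Longrightarrow> mod_additive p (l i)"
    and "\<And>z. z \<in> H \<longleftrightarrow> (\<forall>i<s. p dvd l i z)"
    and "card (UNIV :: 'a set) = card H * p ^ s"
proof -
  have p0: "p > 0" using p prime_gt_0_nat by simp
  obtain s :: nat and b where bij: "bij_betw (\<lambda>(h, c). h + (\<Sum>i<s. of_nat (c i) * b i))
           (H \<times> ({..<s} \<rightarrow>\<^sub>E {..<p})) UNIV" (is "bij_betw ?f ?X UNIV")
    using complement_basis[OF assms] by blast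
  define g where "g = the_inv_into ?X ?f"
  have gX: "g z \<in> ?X" for z
    unfolding g_def using bij by (intro the_inv_into_into[OF _ _ subset_refl]) (auto simp: bij_betw_def)
  have fg: "?f (g z) = z" for z
    unfolding g_def by (rule f_the_inv_into_f_bij_betw[OF bij]) simp
  have gf: "g (?f x) = x" if "x \<in> ?X" for x
    unfolding g_def using bij that by (intro the_inv_into_f_f) (auto simp: bij_betw_def)
  define l where "l i z = snd (g z) i" for i z
  have add: "mod_additive p (l i)" if i: "i < s" for i
    unfolding mod_additive_def
  proof (intro allI)
    fix x y
    obtain h c where x: "g x = (h, c)" by force
    obtain h' c' where y: "g y = (h', c')" by force
    \<comment> \<open>Reducing modulo \<open>p\<close> returns the added coordinates to the box and,
      in characteristic \<open>p\<close>, does not change the element.\<close>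
    define d where "d = (\<lambda>i\<in>{..<s}. (c i + c' i) mod p)"
    have mem: "(h + h', d) \<in> ?X"
      using gX[of x] gX[of y] H(2) p0 by (auto simp: x y d_def)
    have "?f (h + h', d) = (h + h') + (\<Sum>i<s. of_nat (c i + c' i) * b i)"
    proof -
      have "(of_nat (d i) :: 'a) = of_nat (c i + c' i)" if "i < s" for i
        using that p(2) by (intro of_nat_cong_CHAR) (simp add: d_def cong_def)
      then show ?thesis by simp
    qed
    also have "\<dots> = ?f (g x) + ?f (g y)"
      by (simp add: x y sum.distrib algebra_simps)
    also have "\<dots> = x + y" by (simp only: fg)
    finally have "g (x + y) = (h + h', d)" using gf[OF mem] by simp
    then show "[l i (x + y) = l i x + l i y] (mod p)"
      using i by (simp add: l_def x y d_def cong_def)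
  qed
  have iff: "z \<in> H \<longleftrightarrow> (\<forall>i<s. p dvd l i z)" for z
  proof
    assume z: "z \<in> H"
    have mem: "(z, \<lambda>i\<in>{..<s}. 0) \<in> ?X" using z p0 by auto
    have "g z = (z, \<lambda>i\<in>{..<s}. 0)" using gf[OF mem] by simp
    then show "\<forall>i<s. p dvd l i z" by (simp add: l_def)
  next
    assume l: "\<forall>i<s. p dvd l i z"
    obtain h c where z: "g z = (h, c)" by force
    have "c i = 0" if "i < s" for i
    proof (rule ccontr)
      assume "c i \<noteq> 0"
      moreover have "p dvd c i" using l that by (simp add: l_def z)
      moreover have "c i < p" using gX[of z] that by (auto simp: z)
      ultimately show False using nat_dvd_not_less by blast
    qed
    then have "h = z" using fg[of z] by (simp add: z)
    then show "z \<in> H" using gX[of z] by (simp add: z)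
  qed
  have "card (UNIV :: 'a set) = card H * p ^ s"
    using bij_betw_same_card[OF bij] by (simp add: card_cartesian_product card_PiE)
  with add iff show thesis by (rule that)
qed

text \<open>Membership in \<open>H\<close> is a product of \<open>s\<close> indicators of weight
  \<open>(p - 1) * D\<close> each; its sum over the box is the count.\<close>

lemma liftable_preimage_count_dvd:
  fixes H :: "'a::{finite,comm_ring_1} set"
  assumes p: "prime CHAR('a)" "p = CHAR('a)"
    and H: "0 \<in> H" "\<And>x y. x \<in> H \<Longrightarrow> y \<in> H \<Longrightarrow> x + y \<in> H"
    and F: "liftable p J D F" and J: "finite J" and D: "D \<ge> 1" "(v - 1) * D < card J"
    and s: "card (UNIV :: 'a set) = card H * p ^ s"
  shows "p ^ (v - s) dvd card {x \<in> J \<rightarrow>\<^sub>E {..<p}. F x \<in> H}"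
proof -
  have pp: "prime p" using p by simp
  obtain s' l where l: "\<And>i. i < s' \<Longrightarrow> mod_additive p (l i)"
    and mem: "\<And>z. z \<in> H \<longleftrightarrow> (\<forall>i<s'. p dvd l i z)"
    and card': "card (UNIV :: 'a set) = card H * p ^ s'"
    using subgroup_coordinates[OF p H] by metis
  have "card H \<noteq> 0" using H(1) by (auto simp: card_eq_0_iff)
  then have "s' = s" using s card' prime_gt_1_nat[OF pp] by simp
  let ?X = "J \<rightarrow>\<^sub>E {..<p}"
  have fin: "finite ?X" using J by (simp add: finite_PiE)
  have "\<exists>g. weighted p J D ((p - 1) * D) g \<and> (\<forall>x\<in>?X. g x = of_bool (p dvd l i (F x)))"
    if i: "i < s" for i
  proof -
    obtain h where h: "deg_le J D (\<lambda>x. int (h x))" "\<And>x. [l i (F x) = h x] (mod p)"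
      using F l i \<open>s' = s\<close> unfolding liftable_def by blast
    obtain g where g: "weighted p J D ((p - 1) * D) g" "\<And>x. x \<in> ?X \<Longrightarrow> g x = of_bool (p dvd h x)"
      using weighted_indicator[OF pp fin h(1)] by metis
    have "p dvd l i (F x) \<longleftrightarrow> p dvd h x" for x using cong_dvd_iff[OF h(2)] .
    then show ?thesis using g by auto
  qed
  then have "\<forall>i. \<exists>g. i < s \<longrightarrow> weighted p J D ((p - 1) * D) g \<and> (\<forall>x\<in>?X. g x = of_bool (p dvd l i (F x)))"
    by blast
  then obtain g where g: "\<And>i. i < s \<Longrightarrow> weighted p J D ((p - 1) * D) (g i)"
    "\<And>i x. i < s \<Longrightarrow> x \<in> ?X \<Longrightarrow> g i x = of_bool (p dvd l i (F x))"
    by metis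
  have "weighted p J D (s * ((p - 1) * D)) (\<lambda>x. \<Prod>i<s. g i x)"
    using weighted_prod[of "{..<s}" p J D "(p - 1) * D" g] g(1) by simp
  from weighted_box_sum_dvd[OF pp J this D(2,1)]
  have "int p ^ (v - s) dvd (\<Sum>x\<in>?X. \<Prod>i<s. g i x)" .
  also have "(\<Sum>x\<in>?X. \<Prod>i<s. g i x) = (\<Sum>x\<in>?X. of_bool (F x \<in> H))"
  proof (rule sum.cong[OF refl])
    fix x assume x: "x \<in> ?X"
    have "(\<Prod>i<s. g i x) = (\<Prod>i<s. of_bool (p dvd l i (F x)))"
      using g(2) x by (intro prod.cong) auto
    also have "\<dots> = of_bool (\<forall>i\<in>{..<s}. p dvd l i (F x))"
      by (induction s) (auto simp: lessThan_Suc)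
    finally show "(\<Prod>i<s. g i x) = of_bool (F x \<in> H)" using mem \<open>s' = s\<close> by auto
  qed
  also have "\<dots> = int (card {x \<in> ?X. F x \<in> H})"
    using fin by (simp add: Int_def)
  finally show ?thesis by (metis of_nat_dvd_iff of_nat_power)
qed

section \<open>Counting points\<close>

text \<open>Multiplication by a nonzero \<open>x\<close> permutes the nonzero elements; their
  product is compared before and after.\<close>

lemma power_card_UNIV: "(x :: 'a::{finite,field}) ^ card (UNIV :: 'a set) = x"
proof (cases "x = 0")
  case True
  then show ?thesis by (simp add: power_0_left)
next
  case False
  let ?U = "UNIV - {0 :: 'a}"
  have "bij_betw ((*) x) ?U ?U"
    using False by (intro bij_betw_byWitness[where f' = "\<lambda>y. y / x"]) auto
  then have "(\<Prod>y\<in>?U. x * y) = \<Prod>?U" by (rule prod.reindex_bij_betw)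
  then have "x ^ card ?U * \<Prod>?U = 1 * \<Prod>?U" by (simp add: prod.distrib)
  then have "x ^ card ?U = 1" by (simp only: mult_cancel_right) simp
  then have "x ^ Suc (card ?U) = x" by simp
  also have "Suc (card ?U) = card (UNIV :: 'a set)" by (rule card_Suc_Diff1) auto
  finally show ?thesis .
qed

text \<open>With \<open>Q\<close> the field size, \<open>x^Q = x\<close> lets an exponent
  \<open>n \<ge> Q\<close> drop to \<open>n - Q + 1\<close>. This stays positive, so
  \<open>x = 0\<close> is no exception, and exponents end up in the range of
  \<open>W_p\<close>.\<close>

lemma exponent_reduction:
  obtains t where "t \<le> card (UNIV :: 'a::{finite,field} set) - 1" and "t \<le> n"
    and "\<And>x :: 'a. x ^ t = x ^ n"
proof -
  let ?Q = "card (UNIV :: 'a set)"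
  have Q: "?Q \<ge> 2" using card_mono[of UNIV "{0, 1 :: 'a}"] by simp
  have "\<exists>t \<le> ?Q - 1. t \<le> n \<and> (\<forall>x :: 'a. x ^ t = x ^ n)"
  proof (induction n rule: less_induct)
    case (less n)
    show ?case
    proof (cases "n \<le> ?Q - 1")
      case False
      define n' where "n' = n - ?Q + 1"
      have "n' < n" using False Q by (auto simp: n'_def)
      from less.IH[OF this] obtain t where t: "t \<le> ?Q - 1" "t \<le> n'" "\<And>x :: 'a. x ^ t = x ^ n'"
        by blast
      have "x ^ n' = x ^ n" for x :: 'a
      proof -
        have "n = ?Q + (n - ?Q)" using False by simp
        then have "x ^ n = x ^ ?Q * x ^ (n - ?Q)" by (metis power_add)
        also have "\<dots> = x ^ n'" by (simp add: power_card_UNIV n'_def)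
        finally show ?thesis by simp
      qed
      then show ?thesis using t \<open>n' < n\<close> by (metis le_less_trans less_imp_le)
    qed auto
  qed
  then show thesis using that by blast
qed

lemma digit_weight_le_W_p:
  assumes "\<And>i. i < k \<Longrightarrow> t i \<le> Q - 1" and "(\<Sum>i<k. t i) \<le> d"
  shows "(\<Sum>i<k. digit_sum p (t i)) \<le> W_p p d Q k"
proof -
  let ?S = "{(\<Sum>i<k. digit_sum p (t i)) | t. t \<in> ({..<k} \<rightarrow>\<^sub>E {0..Q - 1}) \<and> (\<Sum>i<k. t i) \<le> d}"
  have "?S \<subseteq> (\<lambda>t. \<Sum>i<k. digit_sum p (t i)) ` ({..<k} \<rightarrow>\<^sub>E {0..Q - 1})"
    by blast
  then have "finite ?S" by (rule finite_subset) (simp add: finite_PiE)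
  moreover have "(\<Sum>i<k. digit_sum p (t i)) \<in> ?S"
    using assms by (intro CollectI exI[of _ "restrict t {..<k}"])
      (auto simp del: digit_sum.simps)
  ultimately show ?thesis unfolding W_p_def by (rule Max_ge)
qed

text \<open>The exponent vector \<open>(1, 0, ..., 0)\<close> is admissible and has digit weight
  1.\<close>

lemma W_p_ge_1:
  assumes "p \<ge> 2" and "Q \<ge> 2" and "k \<ge> 1" and "d \<ge> 1"
  shows "W_p p d Q k \<ge> 1"
proof -
  let ?t = "\<lambda>i :: nat. of_bool (i = 0) :: nat"
  have one: "digit_sum p (Suc 0) = 1"
    using assms(1) by (subst digit_sum.simps) simp
  have zero: "0 \<in> {..<k}" using assms(3) by simp
  have "(\<Sum>i<k. ?t i) = 1"
    using zero by (simp add: sum.remove[of "{..<k}" 0])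
  moreover have "(\<Sum>i<k. digit_sum p (?t i)) \<ge> digit_sum p (?t 0)"
    using zero by (intro member_le_sum) auto
  moreover have "(\<Sum>i<k. digit_sum p (?t i)) \<le> W_p p d Q k"
    by (rule digit_weight_le_W_p) (use assms calculation(1) in auto)
  ultimately show ?thesis using one by (simp del: digit_sum.simps)
qed

text \<open>In coordinates each monomial is a product of powers of linear forms;
  \<open>exponent_reduction\<close> does not raise its total degree, so \<open>W_p\<close> bounds
  the digit sums.\<close>

lemma mpoly_eval_liftable:
  fixes f :: "(nat \<Rightarrow>\<^sub>0 nat) \<Rightarrow>\<^sub>0 'a::{finite,field}" and v :: "nat \<Rightarrow> 'j \<Rightarrow> 'a"
  assumes p: "prime CHAR('a)" "p = CHAR('a)"
    and vars: "mpoly_vars_in f k" and deg: "mpoly_total_degree f \<le> d"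
  shows "liftable p J (W_p p d (card (UNIV :: 'a set)) k)
    (\<lambda>x. mpoly_eval f (\<lambda>i. \<Sum>j\<in>I i. of_nat (x j) * v i j))"
  unfolding mpoly_eval_def
proof (intro liftable_sum liftable_cmult)
  fix mon assume mon: "mon \<in> Poly_Mapping.keys f"
  let ?e = "Poly_Mapping.lookup mon" and ?Q = "card (UNIV :: 'a set)"
  let ?L = "\<lambda>x i. \<Sum>j\<in>I i. of_nat (x j) * v i j"
  have keys: "Poly_Mapping.keys mon \<subseteq> {..<k}"
    using vars mon by (simp add: mpoly_vars_in_def)
  have "\<forall>i. \<exists>t. t \<le> ?Q - 1 \<and> t \<le> ?e i \<and> (\<forall>x :: 'a. x ^ t = x ^ ?e i)"
    using exponent_reduction[where 'a = 'a] by metis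
  then obtain t where t: "\<And>i. t i \<le> ?Q - 1" "\<And>i. t i \<le> ?e i"
    "\<And>i (x :: 'a). x ^ t i = x ^ ?e i"
    by metis
  have "(\<Sum>i<k. t i) \<le> (\<Sum>i<k. ?e i)" by (intro sum_mono t)
  also have "\<dots> = (\<Sum>i\<in>Poly_Mapping.keys mon. ?e i)"
    using keys by (intro sum.mono_neutral_right) (auto simp: in_keys_iff)
  also have "\<dots> \<le> mpoly_total_degree f"
    unfolding mpoly_total_degree_def using mon by (intro Max_ge) auto
  also note deg
  finally have "(\<Sum>i<k. digit_sum p (t i)) \<le> W_p p d ?Q k"
    by (intro digit_weight_le_W_p t)
  \<comment> \<open>Exponents outside the support of \<open>mon\<close> are 0, so the product
    extends to all \<open>i < k\<close>.\<close>
  moreover have "(\<Prod>i\<in>Poly_Mapping.keys mon. ?L x i ^ ?e i) = (\<Prod>i<k. ?L x i ^ t i)" for x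
    unfolding t(3) using keys
    by (intro prod.mono_neutral_left) (auto simp: in_keys_iff)
  ultimately show "liftable p J (W_p p d ?Q k) (\<lambda>x. \<Prod>i\<in>Poly_Mapping.keys mon. ?L x i ^ ?e i)"
    using liftable_prod_linear_power[OF p, of "{..<k}" J t v I] by (simp add: liftable_mono)
qed

lemma mpoly_eval_cong:
  assumes "mpoly_vars_in f k" and "\<And>i. i < k \<Longrightarrow> x i = y i"
  shows "mpoly_eval f x = mpoly_eval f y"
  unfolding mpoly_eval_def
proof (intro sum.cong prod.cong refl arg_cong2[where f = "(*)"])
  fix mon i assume "mon \<in> Poly_Mapping.keys f" "i \<in> Poly_Mapping.keys mon"
  then have "i < k" using assms(1) by (auto simp: mpoly_vars_in_def)
  then show "x i ^ Poly_Mapping.lookup mon i = y i ^ Poly_Mapping.lookup mon i"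
    using assms(2) by simp
qed

text \<open>The given bijection is applied at each index in \<open>A\<close>; the pairs
  \<open>(i, j)\<close> gather all coordinates into a single box.\<close>

lemma coordinate_blocks_bij:
  fixes b :: "nat \<Rightarrow> 'a::comm_ring_1" and P :: "nat set"
  assumes bij: "bij_betw (\<lambda>c. \<Sum>j<M. of_nat (c j) * b j) ({..<M} \<rightarrow>\<^sub>E P) UNIV"
  shows "bij_betw (\<lambda>c. \<lambda>i\<in>A. \<Sum>j<M. of_nat (c (i, j)) * b j)
    (A \<times> {..<M} \<rightarrow>\<^sub>E P) (A \<rightarrow>\<^sub>E UNIV)" (is "bij_betw ?f ?X _")
  unfolding bij_betw_def
proof
  let ?g = "\<lambda>c. \<Sum>j<M. of_nat (c j) * b j"
  let ?r = "\<lambda>c i. \<lambda>j\<in>{..<M}. c (i, j)"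
  have r: "?r c i \<in> {..<M} \<rightarrow>\<^sub>E P" if "c \<in> ?X" "i \<in> A" for c i
    using that by auto
  have g: "?g (?r c i) = ?f c i" if "i \<in> A" for c i
    using that by simp
  show "inj_on ?f ?X"
  proof (rule inj_onI)
    fix c c' assume c: "c \<in> ?X" "c' \<in> ?X" and eq: "?f c = ?f c'"
    have "c (i, j) = c' (i, j)" if "i \<in> A" "j < M" for i j
    proof -
      have "?g (?r c i) = ?g (?r c' i)" using fun_cong[OF eq, of i] that(1) by simp
      then have "?r c i = ?r c' i"
        using inj_onD[OF bij_betw_imp_inj_on[OF bij] _ r[OF c(1) that(1)] r[OF c(2) that(1)]] by blast
      then show ?thesis using that(2) by (metis lessThan_iff restrict_apply')
    qed
    then show "c = c'" using c by (intro PiE_ext[OF c]) auto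
  qed
  show "?f ` ?X = A \<rightarrow>\<^sub>E UNIV"
  proof
    show "?f ` ?X \<subseteq> A \<rightarrow>\<^sub>E UNIV" by auto
    show "A \<rightarrow>\<^sub>E UNIV \<subseteq> ?f ` ?X"
    proof
      fix x :: "'b \<Rightarrow> 'a" assume x: "x \<in> A \<rightarrow>\<^sub>E UNIV"
      define C where "C = inv_into ({..<M} \<rightarrow>\<^sub>E P) ?g"
      have surj: "z \<in> ?g ` ({..<M} \<rightarrow>\<^sub>E P)" for z
        using bij_betw_imp_surj_on[OF bij] by simp
      have C: "C z \<in> {..<M} \<rightarrow>\<^sub>E P" "?g (C z) = z" for z
        unfolding C_def using inv_into_into[OF surj] f_inv_into_f[OF surj] by blast+
      define c where "c = (\<lambda>(i, j)\<in>A \<times> {..<M}. C (x i) j)"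
      have "c \<in> ?X" using C(1) by (auto simp: c_def)
      moreover have "?f c = x"
      proof
        fix i
        show "?f c i = x i"
        proof (cases "i \<in> A")
          case True
          then have "?f c i = ?g (C (x i))" by (simp add: c_def)
          then show ?thesis using C(2) by simp
        next
          case False
          then show ?thesis using x by (auto simp: PiE_iff extensional_def)
        qed
      qed
      ultimately show "x \<in> ?f ` ?X" by blast
    qed
  qed
qed

section \<open>Fibres of additive maps and the final count\<close>

text \<open>A nonempty fibre is a translate of the kernel.\<close>

lemma card_additive_preimage:
  fixes L :: "'a::{finite,ab_group_add} \<Rightarrow> 'a"
  assumes "\<And>x y. L (x + y) = L x + L y"
  shows "card {y. L y = z} = (if z \<in> range L then card {y. L y = 0} else 0)"
proof (cases "z \<in> range L")
  case True
  then obtain w where w: "z = L w" by blast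
  have "bij_betw ((+) w) {y. L y = 0} {y. L y = z}"
  proof (rule bij_betw_byWitness[where f' = "\<lambda>y. y - w"])
    show "(\<lambda>y. y - w) ` {y. L y = z} \<subseteq> {y. L y = 0}"
    proof clarify
      fix y assume "z = L y"
      then have "L (y - w) + L w = L w" using assms[of "y - w" w] w by simp
      then show "L (y - w) = 0" by simp
    qed
  qed (auto simp: assms w)
  from bij_betw_same_card[OF this] show ?thesis using True by simp
next
  case False
  then have "{y. L y = z} = {}" by auto
  then show ?thesis using False by simp
qed

lemma card_additive_equation:
  fixes L :: "'a::{finite,ab_group_add} \<Rightarrow> 'a"
  assumes "\<And>x y. L (x + y) = L x + L y" and "finite X"
  shows "card {(x, y). x \<in> X \<and> F x = L y} = card {y. L y = 0} * card {x \<in> X. F x \<in> range L}"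
proof -
  have "{(x, y). x \<in> X \<and> F x = L y} = (SIGMA x:X. {y. L y = F x})" by auto
  then have "card {(x, y). x \<in> X \<and> F x = L y} = (\<Sum>x\<in>X. card {y. L y = F x})"
    using assms(2) by simp
  also have "\<dots> = (\<Sum>x\<in>X. if F x \<in> range L then card {y. L y = 0} else 0)"
    by (intro sum.cong refl card_additive_preimage assms(1))
  also have "\<dots> = (\<Sum>x\<in>{x \<in> X. F x \<in> range L}. card {y. L y = 0})"
    by (rule sum.inter_filter[OF assms(2), symmetric])
  also have "\<dots> = card {y. L y = 0} * card {x \<in> X. F x \<in> range L}"
    by (simp only: sum_constant of_nat_id mult.commute)
  finally show ?thesis .
qed

lemma card_kernel_range:
  fixes L :: "'a::{finite,ab_group_add} \<Rightarrow> 'a"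
  assumes "\<And>x y. L (x + y) = L x + L y"
  shows "card (UNIV :: 'a set) = card {y. L y = 0} * card (range L)"
proof -
  \<comment> \<open>\<open>UNIV\<close> is identified with the graph of \<open>L\<close>, so that
    \<open>card_additive_equation\<close> applies with \<open>F\<close> the identity.\<close>
  have "bij_betw (\<lambda>y. (L y, y)) UNIV {(x, y). x \<in> UNIV \<and> x = L y}"
    by (auto simp: bij_betw_def inj_on_def)
  then have "card (UNIV :: 'a set) = card {(x, y). x \<in> UNIV \<and> x = L y}"
    by (rule bij_betw_same_card)
  also have "\<dots> = card {y. L y = 0} * card {x \<in> UNIV. x \<in> range L}"
    by (rule card_additive_equation[OF assms]) simp
  finally show ?thesis by simp
qed

text \<open>If the kernel of \<open>L\<close> has size \<open>p^r\<close>, its range has codimension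
  \<open>r\<close>: the kernel contributes \<open>p^r\<close>, and the number of \<open>x\<close>
  with value in the range contributes \<open>p^(v - r)\<close>.\<close>

lemma N_count_dvd:
  fixes f :: "(nat \<Rightarrow>\<^sub>0 nat) \<Rightarrow>\<^sub>0 'a::{finite,field}"
  assumes p: "prime CHAR('a)" "p = CHAR('a)"
    and vars: "mpoly_vars_in f k" and deg: "mpoly_total_degree f \<le> d"
    and card: "card (UNIV :: 'a set) = p ^ M"
    and W: "W_p p d (p ^ M) k \<ge> 1" "(v - 1) * W_p p d (p ^ M) k < k * M"
  shows "p ^ v dvd N_count f k (p ^ e)"
proof -
  have p1: "p > 1" using p prime_gt_1_nat by simp
  define L :: "'a \<Rightarrow> 'a" where "L y = y ^ p ^ e - y" for y
  have L: "L (x + y) = L x + L y" for x y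
    using freshmans_dream'[OF p(1), of "p ^ e" e x y] p(2) by (simp add: L_def)
  have L0: "L 0 = 0" using p1 by (simp add: L_def power_0_left)
  obtain s and b :: "nat \<Rightarrow> 'a"
    where b: "bij_betw (\<lambda>c. \<Sum>i<s. of_nat (c i) * b i) ({..<s} \<rightarrow>\<^sub>E {..<p}) UNIV"
      and s: "card (UNIV :: 'a set) = p ^ s"
    by (rule prime_char_basis[OF p])
  have sM: "s = M" using s card p1 by simp
  have ran: "0 \<in> range L" "\<And>x y. x \<in> range L \<Longrightarrow> y \<in> range L \<Longrightarrow> x + y \<in> range L"
    using L L0 by (auto simp flip: L intro: range_eqI[of _ _ 0])
  obtain r where r: "card (UNIV :: 'a set) = card (range L) * p ^ r"
    by (rule subgroup_coordinates[OF p ran])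
  have "card (range L) > 0" by (simp add: card_gt_0_iff)
  then have ker: "card {y. L y = 0} = p ^ r"
    using r card_kernel_range[of L] L by (simp add: mult.commute)
  let ?J = "{..<k} \<times> {..<M}"
  \<comment> \<open>Summing over pairs presents each variable as a linear form in the coordinates
    indexed by \<open>?J\<close>, as \<open>mpoly_eval_liftable\<close> expects.\<close>
  let ?E = "\<lambda>c i. \<Sum>j\<in>{i} \<times> {..<M}. of_nat (c j) * b (snd j)"
  let ?F = "\<lambda>c. mpoly_eval f (?E c)"
  let ?X = "{..<k} \<rightarrow>\<^sub>E (UNIV :: 'a set)"
  have E: "?E c i = (\<Sum>j<M. of_nat (c (i, j)) * b j)" for c i
    by (rule sum.reindex_bij_witness[of _ "Pair i" snd]) auto
  have lift: "liftable p ?J (W_p p d (p ^ M) k) ?F"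
    using mpoly_eval_liftable[OF p vars deg, of ?J "\<lambda>_ j. b (snd j)" "\<lambda>i. {i} \<times> {..<M}"] card by simp
  have "p ^ (v - r) dvd card {c \<in> ?J \<rightarrow>\<^sub>E {..<p}. ?F c \<in> range L}"
    by (intro liftable_preimage_count_dvd[OF p _ _ lift _ W(1) _ r] ran) (use W(2) in auto)
  also have "card {c \<in> ?J \<rightarrow>\<^sub>E {..<p}. ?F c \<in> range L} = card {x \<in> ?X. mpoly_eval f x \<in> range L}"
  proof -
    let ?\<theta> = "\<lambda>c. \<lambda>i\<in>{..<k}. \<Sum>j<M. of_nat (c (i, j)) * b j"
    have \<theta>: "bij_betw ?\<theta> (?J \<rightarrow>\<^sub>E {..<p}) ?X"
      using coordinate_blocks_bij b sM by blast
    have "mpoly_eval f (?\<theta> c) = ?F c" for c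
      by (intro mpoly_eval_cong[OF vars]) (simp only: E restrict_apply lessThan_iff if_True)
    then have "?\<theta> ` {c \<in> ?J \<rightarrow>\<^sub>E {..<p}. ?F c \<in> range L} = {x \<in> ?X. mpoly_eval f x \<in> range L}"
      unfolding bij_betw_imp_surj_on[OF \<theta>, symmetric] by (auto simp del: restrict_apply)
    moreover have "inj_on ?\<theta> {c \<in> ?J \<rightarrow>\<^sub>E {..<p}. ?F c \<in> range L}"
      using bij_betw_imp_inj_on[OF \<theta>] by (rule inj_on_subset) blast
    ultimately have "bij_betw ?\<theta> {c \<in> ?J \<rightarrow>\<^sub>E {..<p}. ?F c \<in> range L} {x \<in> ?X. mpoly_eval f x \<in> range L}"
      unfolding bij_betw_def by blast
    then show ?thesis by (rule bij_betw_same_card)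
  qed
  finally have "p ^ r * p ^ (v - r) dvd p ^ r * card {x \<in> ?X. mpoly_eval f x \<in> range L}"
    by (rule mult_dvd_mono[OF dvd_refl])
  also have "\<dots> = card {(x, y). x \<in> ?X \<and> mpoly_eval f x = L y}"
    unfolding ker[symmetric]
    by (rule card_additive_equation[symmetric]) (auto simp: L finite_PiE)
  also have "\<dots> = N_count f k (p ^ e)"
    by (simp add: N_count_def L_def)
  finally have "p ^ (r + (v - r)) dvd N_count f k (p ^ e)" by (simp add: power_add)
  \<comment> \<open>\<open>v - r\<close> is truncated, so the exponent may exceed
    \<open>v\<close>.\<close>
  moreover have "p ^ v dvd p ^ (r + (v - r))" by (intro le_imp_power_dvd) simp
  ultimately show ?thesis by (rule dvd_trans[rotated])
qed

theorem theorem5p7: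
  fixes f :: "((nat \<Rightarrow>\<^sub>0 nat) \<Rightarrow>\<^sub>0 'a::{finite,field})"
    and p e m k d :: nat
  assumes "prime p" and "e \<ge> 1"
    and "card (UNIV :: 'a set) = (p ^ e) ^ m"
    and "m \<ge> 1" and "k \<ge> 1"
    and "mpoly_vars_in f k"
    and "mpoly_total_degree f = d" and "d \<ge> 1"
  shows "N_count f k (p ^ e) = 0 \<or>
         \<lceil>real (e * m * k) / real (W_p p d ((p ^ e) ^ m) k)\<rceil>
           \<le> int (multiplicity p (N_count f k (p ^ e)))"
proof (cases "N_count f k (p ^ e) = 0")
  \<comment> \<open>The zero count is split off because \<open>multiplicity p 0\<close> is 0,
    whereas the valuation of 0 is infinite.\<close>
  case N: False
  have card: "card (UNIV :: 'a set) = p ^ (e * m)" using assms(3) by (simp add: power_mult)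
  have "prime CHAR('a)" by (intro prime_CHAR_semidom finite_imp_CHAR_pos) simp
  moreover have "CHAR('a) dvd p ^ (e * m)" using CHAR_dvd_CARD[where 'a = 'a] card by simp
  ultimately have p: "prime CHAR('a)" "p = CHAR('a)"
    using assms(1) prime_dvd_power primes_dvd_imp_eq by blast+
  let ?W = "W_p p d (p ^ (e * m)) k"
  let ?v = "\<lceil>real (e * m * k) / real ?W\<rceil>"
  have "p ^ (e * m) \<ge> 2" using card card_mono[of UNIV "{0, 1 :: 'a}"] by simp
  then have W: "?W \<ge> 1" using W_p_ge_1 prime_ge_2_nat assms by simp
  have n: "e * m * k \<ge> 1" using assms by simp
  \<comment> \<open>A ceiling exceeds its argument by less than one; clearing the denominator yields
    the strict inequality that \<open>N_count_dvd\<close> requires.\<close>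
  have "real (nat ?v - 1) < real (e * m * k) / real ?W"
  proof -
    have "0 < real (e * m * k) / real ?W" using W n by simp
    then show ?thesis by linarith
  qed
  then have "real ((nat ?v - 1) * ?W) < real (e * m * k)"
    using W by (simp add: less_divide_eq)
  then have "(nat ?v - 1) * ?W < k * (e * m)"
    by (simp only: of_nat_less_iff mult.commute)
  from N_count_dvd[OF p assms(6) _ card W this, of e] assms(7)
  have "p ^ nat ?v dvd N_count f k (p ^ e)" by simp
  then have "nat ?v \<le> multiplicity p (N_count f k (p ^ e))"
    using N assms(1) by (intro multiplicity_geI) auto
  then have "?v \<le> int (multiplicity p (N_count f k (p ^ e)))" by linarith
  then show ?thesis by (simp only: power_mult simp_thms)
qed simp

end
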